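(* Let $G$ be an undirected uniformly colored graph of type $(p,q,r)$ with degree $s$. For $k=1,\dots,p$, let $H_k$ be the subgraph of $G$ consisting of the edges colored with the $k$th color (and the vertices incident to them). Then $H_1,\dots,H_p$ is a decomposition of $G$ into $p$ (edge-)disjoint subgraphs, all isomorphic to the disjoint sum $K_2+\cdots+K_2$ of $r$ copies of $K_2$. Conversely, let $G=(V,E)$ be an undirected $s$-regular graph with $q$ vertices, and let $H_1,\dots,H_p$ be a decomposition of $G$ into (edge-)disjoint subgraphs, each isomorphic to the same disjoint sum $K_2+\cdots+K_2$. Then the coloring $c:E\to\{1,\dots,p\}$ that colors an edge $k$ if it is in $H_k$ is a uniform edge coloring of $G$.
   Context: Graphs have no loops or multiple edges. A uniform edge coloring of type $(p,q,r)$ ($p,q,r$ positive integers) with degree $s\ge 1$ on an undirected $s$-regular graph $(V,E)$ with $q$ vertices is a surjective map $c:E\to S$, $|S|=p$, such that adjacent edges have different colors (the coloring is proper) and $|c^{-1}(\{k\})|=r$ for every $k\in S$. An undirected graph with such a coloring is a uniformly colored graph of type $(p,q,r)$ with degree $s$. A decomposition of a graph $G$ is a set of subgraphs $H_1,\dots,H_p$ whose edge sets partition the edges of $G$. $K_2$ is the complete graph on two vertices; $K_2+\cdots+K_2$ is the disjoint sum of some number $r\ge 1$ of copies of $K_2$. *)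

theory Defs
  imports Main "HOL-Library.Disjoint_Sets"
begin

text \<open>Undirected graphs: an edge is the set of its two endpoints, which rules out loops and
  multiple edges.\<close>

datatype 'v graph = Graph (vertices: "'v set") (edges: "'v set set")

definition simple_graph :: "'v graph \<Rightarrow> bool" where
  "simple_graph G \<longleftrightarrow> (\<forall>e\<in>edges G. e \<subseteq> vertices G \<and> card e = 2)"

definition regular_graph :: "nat \<Rightarrow> 'v graph \<Rightarrow> bool" where
  "regular_graph s G \<longleftrightarrow> (\<forall>v\<in>vertices G. card {e \<in> edges G. v \<in> e} = s)"

definition subgraph :: "'v graph \<Rightarrow> 'v graph \<Rightarrow> bool" where
  "subgraph H G \<longleftrightarrow> simple_graph H \<and> vertices H \<subseteq> vertices G \<and> edges H \<subseteq> edges G"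

definition graph_isomorphic :: "'v graph \<Rightarrow> 'w graph \<Rightarrow> bool" where
  "graph_isomorphic G H \<longleftrightarrow>
    (\<exists>f. bij_betw f (vertices G) (vertices H) \<and>
      (\<forall>u\<in>vertices G. \<forall>v\<in>vertices G. {u, v} \<in> edges G \<longleftrightarrow> {f u, f v} \<in> edges H))"

definition complete_graph :: "nat \<Rightarrow> nat graph" where
  "complete_graph n = Graph {..<n} {e. e \<subseteq> {..<n} \<and> card e = 2}"

definition disjoint_sum :: "'i set \<Rightarrow> ('i \<Rightarrow> 'v graph) \<Rightarrow> ('i \<times> 'v) graph" where
  "disjoint_sum I F =
    Graph (SIGMA i:I. vertices (F i)) (\<Union>i\<in>I. (\<lambda>e. Pair i ` e) ` edges (F i))"

text \<open>\<open>K\<^sub>2 + \<dots> + K\<^sub>2\<close> with \<open>r\<close> summands.\<close>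

definition sum_of_K2 :: "nat \<Rightarrow> (nat \<times> nat) graph" where
  "sum_of_K2 r = disjoint_sum {..<r} (\<lambda>_. complete_graph 2)"

text \<open>The subgraphs are given as a family indexed by \<open>I\<close>. Blocks of a partition are nonempty,
  so distinct indices give distinct subgraphs. Only the edge sets are required to be disjoint;
  the subgraphs may share vertices, and they need not cover isolated vertices of \<open>G\<close>.\<close>

definition decomposition :: "'v graph \<Rightarrow> 'i set \<Rightarrow> ('i \<Rightarrow> 'v graph) \<Rightarrow> bool" where
  "decomposition G I H \<longleftrightarrow>
    (\<forall>i\<in>I. subgraph (H i) G \<and> edges (H i) \<noteq> {}) \<and>
    disjoint_family_on (\<lambda>i. edges (H i)) I \<and>
    (\<Union>i\<in>I. edges (H i)) = edges G"

definition proper_edge_coloring :: "'v graph \<Rightarrow> ('v set \<Rightarrow> 'c) \<Rightarrow> bool" where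
  "proper_edge_coloring G c \<longleftrightarrow>
    (\<forall>e\<in>edges G. \<forall>f\<in>edges G. e \<noteq> f \<and> e \<inter> f \<noteq> {} \<longrightarrow> c e \<noteq> c f)"

text \<open>\<open>c\<close> is a uniform edge coloring of \<open>G\<close>, with color set \<open>S\<close>, of type \<open>(p, q, r)\<close> with
  degree \<open>s\<close>. Only the values of \<open>c\<close> on the edges of \<open>G\<close> matter.\<close>

definition uniform_edge_coloring ::
  "'v graph \<Rightarrow> 'c set \<Rightarrow> ('v set \<Rightarrow> 'c) \<Rightarrow> nat \<Rightarrow> nat \<Rightarrow> nat \<Rightarrow> nat \<Rightarrow> bool" where
  "uniform_edge_coloring G S c p q r s \<longleftrightarrow>
    p \<ge> 1 \<and> q \<ge> 1 \<and> r \<ge> 1 \<and> s \<ge> 1 \<and>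
    simple_graph G \<and> regular_graph s G \<and> finite (vertices G) \<and> card (vertices G) = q \<and>
    finite S \<and> card S = p \<and> c ` edges G = S \<and>
    proper_edge_coloring G c \<and>
    (\<forall>k\<in>S. card {e \<in> edges G. c e = k} = r)"

definition color_subgraph :: "'v graph \<Rightarrow> ('v set \<Rightarrow> 'c) \<Rightarrow> 'c \<Rightarrow> 'v graph" where
  "color_subgraph G c k =
    Graph (\<Union>{e \<in> edges G. c e = k}) {e \<in> edges G. c e = k}"

text \<open>The coloring giving color \<open>i\<close> to the edges of \<open>H i\<close>; on the edges of \<open>G\<close> it is well
  defined when \<open>H\<close> is a decomposition of \<open>G\<close>.\<close>

definition decomposition_coloring :: "'i set \<Rightarrow> ('i \<Rightarrow> 'v graph) \<Rightarrow> 'v set \<Rightarrow> 'i" where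
  "decomposition_coloring I H e = (THE i. i \<in> I \<and> e \<in> edges (H i))"

end

theory Submission
  imports Defs
begin

text \<open>A simple graph is isomorphic to \<open>K\<^sub>2 + \<dots> + K\<^sub>2\<close> with \<open>r\<close> summands iff its \<open>r\<close> edges are
  pairwise disjoint and cover all vertices. A coloring is proper iff every color class consists of
  pairwise disjoint edges, so both directions reduce to this characterization.\<close>

section \<open>The model graph \<open>sum_of_K2\<close>\<close>

lemma card_two_less_two: "e \<subseteq> {..<2::nat} \<and> card e = 2 \<longleftrightarrow> e = {0, 1}"
proof
  assume e: "e \<subseteq> {..<2} \<and> card e = 2"
  then have "e = {..<2}"
    by (intro card_subset_eq) auto
  then show "e = {0, 1}"
    by auto
qed auto

lemma vertices_sum_of_K2: "vertices (sum_of_K2 r) = {..<r} \<times> {..<2}"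
  by (simp add: sum_of_K2_def disjoint_sum_def complete_graph_def)

lemma edges_sum_of_K2: "edges (sum_of_K2 r) = (\<lambda>i. {(i, 0), (i, 1)}) ` {..<r}"
  unfolding sum_of_K2_def disjoint_sum_def complete_graph_def card_two_less_two by auto

lemma simple_sum_of_K2: "simple_graph (sum_of_K2 r)"
  by (auto simp: simple_graph_def vertices_sum_of_K2 edges_sum_of_K2)

lemma card_edges_sum_of_K2: "card (edges (sum_of_K2 r)) = r"
  by (simp add: edges_sum_of_K2 card_image inj_on_def doubleton_eq_iff)

lemma disjoint_edges_sum_of_K2: "disjoint (edges (sum_of_K2 r))"
  by (auto simp: edges_sum_of_K2 disjoint_def)

section \<open>Edges and isomorphisms of simple graphs\<close>

lemma simple_graph_edgeE:
  assumes "simple_graph G" "e \<in> edges G"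
  obtains u v where "e = {u, v}" "u \<noteq> v" "u \<in> vertices G" "v \<in> vertices G"
  using assms by (auto simp: simple_graph_def card_2_iff)

lemma simple_graph_finite_edges:
  assumes "simple_graph G" "finite (vertices G)"
  shows "finite (edges G)"
  using assms by (intro finite_subset[of "edges G" "Pow (vertices G)"]) (auto simp: simple_graph_def)

lemma graph_isomorphic_sym:
  assumes "graph_isomorphic G H"
  shows "graph_isomorphic H G"
proof -
  obtain f where f: "bij_betw f (vertices G) (vertices H)"
    and e: "\<forall>u\<in>vertices G. \<forall>v\<in>vertices G. {u, v} \<in> edges G \<longleftrightarrow> {f u, f v} \<in> edges H"
    using assms by (auto simp: graph_isomorphic_def)
  let ?g = "inv_into (vertices G) f"
  have g: "bij_betw ?g (vertices H) (vertices G)"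
    using f by (rule bij_betw_inv_into)
  have "{u, v} \<in> edges H \<longleftrightarrow> {?g u, ?g v} \<in> edges G"
    if "u \<in> vertices H" "v \<in> vertices H" for u v
    using that e bij_betw_inv_into_right[OF f] bij_betwE[OF g] by simp
  with g show ?thesis
    unfolding graph_isomorphic_def by blast
qed

text \<open>\<open>graph_isomorphic\<close> speaks of pairs of vertices only. In simple graphs every
  edge is such a pair, so the vertex bijection acts on whole edges, which allows edges to be counted
  and their intersections compared.\<close>

lemma graph_isomorphic_edges:
  assumes "simple_graph G" "simple_graph H" "graph_isomorphic G H"
  obtains f where "inj_on f (vertices G)" "bij_betw ((`) f) (edges G) (edges H)"
proof -
  obtain f where f: "bij_betw f (vertices G) (vertices H)"
    and e: "\<forall>u\<in>vertices G. \<forall>v\<in>vertices G. {u, v} \<in> edges G \<longleftrightarrow> {f u, f v} \<in> edges H"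
    using assms(3) by (auto simp: graph_isomorphic_def)
  have inj: "inj_on f (vertices G)"
    using f by (rule bij_betw_imp_inj_on)
  \<comment> \<open>Edges are subsets of \<open>vertices G\<close>, and taking images under an
    injective map is injective on subsets.\<close>
  have "inj_on ((`) f) (edges G)"
    using inj assms(1) by (intro inj_on_subset[OF inj_on_image_Pow]) (auto simp: simple_graph_def)
  moreover have "(`) f ` edges G = edges H"
  proof (intro equalityI subsetI)
    fix d assume "d \<in> (`) f ` edges G"
    then obtain d' where d': "d' \<in> edges G" "d = f ` d'"
      by blast
    obtain u v where uv: "d' = {u, v}" "u \<in> vertices G" "v \<in> vertices G"
      using simple_graph_edgeE[OF assms(1) d'(1)] .
    then have "{f u, f v} \<in> edges H"
      using e d'(1) by blast
    then show "d \<in> edges H"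
      using d'(2) uv(1) by simp
  next
    fix d assume d: "d \<in> edges H"
    obtain x y where xy: "d = {x, y}" "x \<in> vertices H" "y \<in> vertices H"
      using simple_graph_edgeE[OF assms(2) d] .
    obtain u v where uv: "x = f u" "y = f v" "u \<in> vertices G" "v \<in> vertices G"
      using xy bij_betw_imp_surj_on[OF f] by blast
    have "{u, v} \<in> edges G" "d = f ` {u, v}"
      using d e xy uv by auto
    then show "d \<in> (`) f ` edges G"
      by blast
  qed
  ultimately show ?thesis
    using inj that by (simp add: bij_betw_def)
qed

section \<open>Sums of copies of \<open>K2\<close> as matchings\<close>

lemma isomorphic_sum_of_K2_imp_matching:
  assumes "simple_graph H" "graph_isomorphic H (sum_of_K2 r)"
  shows "disjoint (edges H)" "card (edges H) = r"
proof -
  obtain f where inj: "inj_on f (vertices H)"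
    and bij: "bij_betw ((`) f) (edges H) (edges (sum_of_K2 r))"
    using graph_isomorphic_edges[OF assms(1) simple_sum_of_K2 assms(2)] .
  show "card (edges H) = r"
    using bij_betw_same_card[OF bij] by (simp add: card_edges_sum_of_K2)
  show "disjoint (edges H)"
  proof (rule disjointI)
    fix d e assume de: "d \<in> edges H" "e \<in> edges H" "d \<noteq> e"
    \<comment> \<open>Disjointness is pulled back along \<open>f\<close>: distinct edges have
      distinct, hence disjoint, images, while a common vertex of \<open>d\<close> and
      \<open>e\<close> would give a common vertex of the images.\<close>
    then have "f ` d \<noteq> f ` e"
      using bij_betw_imp_inj_on[OF bij] by (auto dest: inj_onD)
    moreover have "f ` d \<in> edges (sum_of_K2 r)" "f ` e \<in> edges (sum_of_K2 r)"
      using de bij_betwE[OF bij] by auto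
    ultimately have "f ` d \<inter> f ` e = {}"
      using disjoint_edges_sum_of_K2 by (auto dest: disjointD)
    then show "d \<inter> e = {}"
      by auto
  qed
qed

text \<open>Number the edges and order the two endpoints of each: a vertex is then determined by the
  index of its edge and its position there, which are the coordinates of a vertex of
  \<open>sum_of_K2 r\<close>. The map is built from the model to \<open>H\<close>, hence the appeal
  to symmetry.\<close>

lemma matching_imp_isomorphic_sum_of_K2:
  assumes simple: "simple_graph H" and disj: "disjoint (edges H)"
    and fin: "finite (edges H)" and card: "card (edges H) = r"
    and cover: "vertices H = \<Union>(edges H)"
  shows "graph_isomorphic H (sum_of_K2 r)"
proof (rule graph_isomorphic_sym)
  obtain g where g: "bij_betw g {..<r} (edges H)"
    using ex_bij_betw_nat_finite[OF fin] card by (auto simp: atLeast0LessThan)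
  have "\<exists>u v. g i = {u, v} \<and> u \<noteq> v" if "i < r" for i
  proof -
    have "g i \<in> edges H"
      using that bij_betwE[OF g] by simp
    then show ?thesis
      by (metis simple_graph_edgeE[OF simple])
  qed
  then obtain a b where ab: "\<And>i. i < r \<Longrightarrow> g i = {a i, b i}" "\<And>i. i < r \<Longrightarrow> a i \<noteq> b i"
    by metis
  \<comment> \<open>Summand \<open>i\<close> goes to edge \<open>g i\<close>; its vertex
    \<open>0\<close> goes to the endpoint \<open>a i\<close> and its vertex \<open>1\<close> to
    \<open>b i\<close>.\<close>
  define h where "h = (\<lambda>(i, j::nat). if j = 0 then a i else b i)"
  have h_in: "h (i, j) \<in> g i" if "i < r" for i j
    using ab(1)[OF that] by (simp add: h_def)
  have edge: "{h (i, 0), h (i, 1)} = g i" if "i < r" for i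
    using ab(1)[OF that] by (simp add: h_def)
  \<comment> \<open>As the edges are disjoint, a vertex lies in only one of them and so recovers the
    index.\<close>
  have index_eq: "i = i'" if "i < r" "i' < r" "x \<in> g i" "x \<in> g i'" for i i' x
  proof -
    have "g i = g i'"
      using that disjointD[OF disj, of "g i" "g i'"] bij_betwE[OF g] by blast
    then show ?thesis
      using that bij_betw_imp_inj_on[OF g] by (auto dest: inj_onD)
  qed
  have inj: "inj_on h ({..<r} \<times> {..<2})"
  proof (rule inj_onI, clarsimp)
    fix i j i' j' :: nat
    assume *: "i < r" "i' < r" "j < 2" "j' < 2" "h (i, j) = h (i', j')"
    then have "i = i'"
      using index_eq h_in by metis
    with * ab(2)[of i] show "i = i' \<and> j = j'"
      by (auto simp: h_def split: if_splits)
  qed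
  have surj: "h ` ({..<r} \<times> {..<2}) = vertices H"
  proof -
    have "h ` ({..<r} \<times> {..<2}) = (\<Union>i<r. {h (i, 0), h (i, 1)})"
      by (force simp: less_2_cases_iff)
    also have "\<dots> = \<Union>(g ` {..<r})"
      using edge by auto
    also have "\<dots> = vertices H"
      using bij_betw_imp_surj_on[OF g] cover by simp
    finally show ?thesis .
  qed
  have "(`) h ` edges (sum_of_K2 r) = (\<lambda>i. {h (i, 0), h (i, 1)}) ` {..<r}"
    by (simp add: edges_sum_of_K2 image_image)
  also have "\<dots> = g ` {..<r}"
    using edge by (intro image_cong) auto
  also have "\<dots> = edges H"
    using bij_betw_imp_surj_on[OF g] .
  finally have edges: "(`) h ` edges (sum_of_K2 r) = edges H" .
  \<comment> \<open>Injectivity is needed on all sets of model vertices, not just on edges: the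
    isomorphism must also send non-edges to non-edges, including the degenerate pairs with
    \<open>x = y\<close>.\<close>
  have inj': "inj_on ((`) h) (Pow ({..<r} \<times> {..<2}))"
    using inj by (rule inj_on_image_Pow)
  have sub: "edges (sum_of_K2 r) \<subseteq> Pow ({..<r} \<times> {..<2})"
    by (auto simp: edges_sum_of_K2)
  have "{x, y} \<in> edges (sum_of_K2 r) \<longleftrightarrow> {h x, h y} \<in> edges H"
    if "x \<in> {..<r} \<times> {..<2}" "y \<in> {..<r} \<times> {..<2}" for x y
    using inj_on_image_mem_iff[OF inj' _ sub, of "{x, y}"] that edges by simp
  then show "graph_isomorphic (sum_of_K2 r) H"
    unfolding graph_isomorphic_def vertices_sum_of_K2
    using inj surj by (auto simp: bij_betw_def)
qed

section \<open>From colorings to decompositions\<close>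

lemma proper_edge_coloring_iff:
  "proper_edge_coloring G c \<longleftrightarrow> (\<forall>k. disjoint {e \<in> edges G. c e = k})"
  unfolding proper_edge_coloring_def disjoint_def by blast

text \<open>Surjectivity onto the colors makes every block nonempty, and injectivity of
  \<open>color\<close> keeps the blocks of different indices disjoint.\<close>

lemma decomposition_color_subgraph:
  assumes "simple_graph G" "inj_on color I" "c ` edges G = color ` I"
  shows "decomposition G I (\<lambda>k. color_subgraph G c (color k))"
  unfolding decomposition_def
proof (intro conjI ballI)
  fix k assume "k \<in> I"
  then have "color k \<in> c ` edges G"
    using assms(3) by simp
  then show "edges (color_subgraph G c (color k)) \<noteq> {}"
    by (auto simp: color_subgraph_def)
  show "subgraph (color_subgraph G c (color k)) G"
    using assms(1) by (auto simp: subgraph_def simple_graph_def color_subgraph_def)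
next
  show "disjoint_family_on (\<lambda>i. edges (color_subgraph G c (color i))) I"
    using assms(2) by (auto simp: disjoint_family_on_def color_subgraph_def dest: inj_onD)
  show "(\<Union>i\<in>I. edges (color_subgraph G c (color i))) = edges G"
    using assms(3) by (auto simp: color_subgraph_def)
qed

lemma color_subgraph_isomorphic_sum_of_K2:
  assumes "simple_graph G" "finite (vertices G)" "proper_edge_coloring G c"
    and "card {e \<in> edges G. c e = k} = r"
  shows "graph_isomorphic (color_subgraph G c k) (sum_of_K2 r)"
proof (rule matching_imp_isomorphic_sum_of_K2)
  show "simple_graph (color_subgraph G c k)"
    using assms(1) by (auto simp: simple_graph_def color_subgraph_def)
  show "disjoint (edges (color_subgraph G c k))"
    using assms(3) by (simp add: color_subgraph_def proper_edge_coloring_iff)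
  show "finite (edges (color_subgraph G c k))"
    using simple_graph_finite_edges[OF assms(1,2)] by (simp add: color_subgraph_def)
qed (use assms(4) in \<open>simp_all add: color_subgraph_def\<close>)

section \<open>From decompositions to colorings\<close>

lemma decomposition_coloring_eq:
  assumes "decomposition G I H" "i \<in> I" "e \<in> edges (H i)"
  shows "decomposition_coloring I H e = i"
  unfolding decomposition_coloring_def
  \<comment> \<open>Uniqueness of the index comes from the disjointness of the edge sets of the
    family.\<close>
  using assms by (intro the_equality) (auto simp: decomposition_def disjoint_family_on_def)

text \<open>This turns facts about the blocks, such as being matchings of size \<open>r\<close>,
  into facts about color classes.\<close>

lemma decomposition_coloring_class:
  assumes "decomposition G I H" "i \<in> I"
  shows "{e \<in> edges G. decomposition_coloring I H e = i} = edges (H i)"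
proof (intro equalityI subsetI)
  fix e assume e: "e \<in> {e \<in> edges G. decomposition_coloring I H e = i}"
  then obtain j where "j \<in> I" "e \<in> edges (H j)"
    using assms(1) by (auto simp: decomposition_def)
  with e decomposition_coloring_eq[OF assms(1)] show "e \<in> edges (H i)"
    by auto
next
  fix e assume "e \<in> edges (H i)"
  with assms decomposition_coloring_eq[OF assms]
  show "e \<in> {e \<in> edges G. decomposition_coloring I H e = i}"
    by (auto simp: decomposition_def)
qed

lemma decomposition_coloring_image:
  assumes "decomposition G I H"
  shows "decomposition_coloring I H ` edges G = I"
proof (intro equalityI subsetI)
  fix i assume "i \<in> decomposition_coloring I H ` edges G"
  then obtain e j where "i = decomposition_coloring I H e" "j \<in> I" "e \<in> edges (H j)"
    using assms unfolding decomposition_def by blast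
  then show "i \<in> I"
    using decomposition_coloring_eq[OF assms] by simp
next
  fix i assume i: "i \<in> I"
  then obtain e where "e \<in> edges (H i)"
    using assms unfolding decomposition_def by blast
  then have "e \<in> edges G" "decomposition_coloring I H e = i"
    using decomposition_coloring_class[OF assms i] by auto
  then show "i \<in> decomposition_coloring I H ` edges G"
    by blast
qed

text \<open>An endpoint of any edge has positive degree. This supplies the positivity of
  \<open>s\<close> and \<open>q\<close> that the converse direction does not assume.\<close>

lemma regular_graph_degree_pos:
  assumes "simple_graph G" "regular_graph s G" "finite (vertices G)" "edges G \<noteq> {}"
  shows "s \<ge> 1" "card (vertices G) \<ge> 1"
proof -
  obtain e where e: "e \<in> edges G"
    using assms(4) by blast
  obtain v where v: "v \<in> e" "v \<in> vertices G"
    using simple_graph_edgeE[OF assms(1) e] by blast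
  have "card {e \<in> edges G. v \<in> e} > 0"
    using e v simple_graph_finite_edges[OF assms(1,3)] by (auto simp: card_gt_0_iff)
  then show "s \<ge> 1"
    using assms(2) v by (simp add: regular_graph_def)
  show "card (vertices G) \<ge> 1"
    using v assms(3) by (auto simp: Suc_le_eq card_gt_0_iff)
qed

lemma uniform_decomposition_coloring:
  fixes I :: "'i set"
  assumes simple: "simple_graph G" and reg: "regular_graph s G" and fin: "finite (vertices G)"
    and I: "finite I" "I \<noteq> {}" and r: "r \<ge> 1"
    and dec: "decomposition G I H"
    and iso: "\<And>i. i \<in> I \<Longrightarrow> graph_isomorphic (H i) (sum_of_K2 r)"
  shows "uniform_edge_coloring G I (decomposition_coloring I H) (card I) (card (vertices G)) r s"
proof -
  let ?c = "decomposition_coloring I H"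
  have "edges G \<noteq> {}"
    using decomposition_coloring_image[OF dec] I(2) by auto
  note pos = regular_graph_degree_pos[OF simple reg fin this]
  have matching: "disjoint (edges (H i))" "card (edges (H i)) = r" if "i \<in> I" for i
    using isomorphic_sum_of_K2_imp_matching[OF _ iso[OF that]] dec that
    by (auto simp: decomposition_def subgraph_def)
  have "disjoint {e \<in> edges G. ?c e = i}" for i
  proof (cases "i \<in> I")
    case True
    then show ?thesis
      using decomposition_coloring_class[OF dec] matching by simp
  next
    \<comment> \<open>\<open>proper_edge_coloring_iff\<close> ranges over all values of the color
      type, so the empty classes outside \<open>I\<close> must be treated too.\<close>
    case False
    then have empty: "{e \<in> edges G. ?c e = i} = {}"
      using decomposition_coloring_image[OF dec] by blast
    show ?thesis
      unfolding empty by (simp add: disjoint_def)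
  qed
  then have "proper_edge_coloring G ?c"
    by (simp add: proper_edge_coloring_iff)
  then show ?thesis
    using pos simple reg fin I r decomposition_coloring_image[OF dec]
      decomposition_coloring_class[OF dec] matching
    by (auto simp: uniform_edge_coloring_def Suc_le_eq card_gt_0_iff)
qed

theorem proposition4p3:
  fixes G :: "'v graph" and p q r s :: nat
  shows "(\<forall>(S :: 'c set) c color.
            uniform_edge_coloring G S c p q r s \<and> bij_betw color {1..p} S \<longrightarrow>
              decomposition G {1..p} (\<lambda>k. color_subgraph G c (color k)) \<and>
              (\<forall>k\<in>{1..p}. graph_isomorphic (color_subgraph G c (color k)) (sum_of_K2 r)))
       \<and> (\<forall>H :: nat \<Rightarrow> 'v graph.
            simple_graph G \<and> regular_graph s G \<and> finite (vertices G) \<and> card (vertices G) = q \<and>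
            p \<ge> 1 \<and> r \<ge> 1 \<and>
            decomposition G {1..p} H \<and>
            (\<forall>k\<in>{1..p}. graph_isomorphic (H k) (sum_of_K2 r)) \<longrightarrow>
              uniform_edge_coloring G {1..p} (decomposition_coloring {1..p} H) p q r s)"
proof (intro conjI allI impI)
  fix S :: "'c set" and c color
  assume "uniform_edge_coloring G S c p q r s \<and> bij_betw color {1..p} S"
  then have uniform: "uniform_edge_coloring G S c p q r s" and bij: "bij_betw color {1..p} S"
    by auto
  show "decomposition G {1..p} (\<lambda>k. color_subgraph G c (color k))"
    using uniform bij
    by (intro decomposition_color_subgraph) (auto simp: uniform_edge_coloring_def bij_betw_def)
  show "\<forall>k\<in>{1..p}. graph_isomorphic (color_subgraph G c (color k)) (sum_of_K2 r)"
    using uniform bij_betwE[OF bij]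
    by (auto simp: uniform_edge_coloring_def intro!: color_subgraph_isomorphic_sum_of_K2)
next
  fix H :: "nat \<Rightarrow> 'v graph"
  assume "simple_graph G \<and> regular_graph s G \<and> finite (vertices G) \<and> card (vertices G) = q \<and>
    p \<ge> 1 \<and> r \<ge> 1 \<and> decomposition G {1..p} H \<and>
    (\<forall>k\<in>{1..p}. graph_isomorphic (H k) (sum_of_K2 r))"
  then show "uniform_edge_coloring G {1..p} (decomposition_coloring {1..p} H) p q r s"
    \<comment> \<open>The index set \<open>{1..p}\<close> has cardinality \<open>p\<close> and is
      nonempty because \<open>p \<ge> 1\<close>.\<close>
    using uniform_decomposition_coloring[of G s "{1..p}" r H] by auto
qed

end
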